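(* Let $(\bar M,g)$ be a Siklos spacetime with defining function $H=H(x_2,x_3,x_4)$ and constant $\beta$, and let $F:M\to\bar M$ be a hypersurface with a Codazzi second fundamental form, whose unit normal is written locally as $$\xi=a\,\partial_1+\frac{x_3}{\beta}\cos\theta\,\partial_3+\frac{x_3}{\beta}\sin\theta\,\partial_4$$ with functions $a,\theta$ on $M$ satisfying $(H''_{33}-H''_{44})\sin(2\theta)=2H''_{34}\cos(2\theta)$ along $M$. Assume that $\cos\theta=0$. Then there exist local coordinates $(u_1,u_2,u_3)$ on $M$ such that, up to isometries of the ambient space, the immersion is explicitly given by $$F(u_1,u_2,u_3)=(u_1,u_2,u_3,f(u_2)),$$ where $f(u_2)$ satisfies the functional equation $H''_{34}(u_2,u_3,f(u_2))=0$. All such hypersurfaces are minimal.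
   Context: A Siklos spacetime is a 4-dimensional Lorentzian manifold $(\bar M,g)$ with global coordinates $(x_1,x_2,x_3,x_4)$ (where $x_3\neq 0$) and metric $g=\frac{\beta^2}{x_3^2}\left(2dx_1dx_2+H\,dx_2^2+dx_3^2+dx_4^2\right)$, where $H=H(x_2,x_3,x_4)$ is a smooth function (the defining function) and $\beta^2=-3/\Lambda$ with $\Lambda<0$ a real constant. Notation: $\partial_i=\frac{\partial}{\partial x_i}$, $H'_i=\partial_iH$, $H''_{ij}=\partial_i\partial_jH$. In expressions on the hypersurface, $x_3$, $H''_{ij}$, etc. mean $x_3\circ F$, $H''_{ij}\circ F$, etc. A hypersurface is an isometric immersion $F:M^3\to\bar M^4$ of pseudo-Riemannian manifolds with unit normal $\xi$, $g(\xi,\xi)\in\{-1,1\}$. With $\nabla,\nabla^M$ the Levi-Civita connections of $\bar M,M$, the second fundamental form $h$ is the symmetric $(0,2)$-tensor defined by $\nabla_XY=\nabla^M_XY+h(X,Y)\xi$ for $X,Y$ tangent to $M$. Its covariant derivative is $(\nabla^Mh)(X,Y,Z)=X(h(Y,Z))-h(\nabla^M_XY,Z)-h(Y,\nabla^M_XZ)$. The hypersurface has a Codazzi second fundamental form if $\nabla^Mh$ is totally symmetric. The mean curvature is $\mathrm{tr}_{g_M}h=\frac13\sum g_M^{ij}h_{ij}$, where $g_M$ is the induced metric on $M$; the hypersurface is minimal if it vanishes identically. *)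

theory Defs
  imports "HOL-Analysis.Analysis"
begin

section \<open>Smooth maps on open sets\<close>

text \<open>Used for open \<open>S\<close> only. A \<open>C\<^sup>k\<^sup>+\<^sup>1\<close> map is a differentiable map all of whose directional
  derivatives are \<open>C\<^sup>k\<close>.\<close>

primrec Ck_on :: "nat \<Rightarrow> 'a set \<Rightarrow> ('a::euclidean_space \<Rightarrow> 'b::real_normed_vector) \<Rightarrow> bool" where
  "Ck_on 0 S f \<longleftrightarrow> continuous_on S f"
| "Ck_on (Suc k) S f \<longleftrightarrow>
     (\<forall>x\<in>S. f differentiable (at x)) \<and> (\<forall>v. Ck_on k S (\<lambda>x. frechet_derivative f (at x) v))"

definition smooth_on :: "'a set \<Rightarrow> ('a::euclidean_space \<Rightarrow> 'b::real_normed_vector) \<Rightarrow> bool" where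
  "smooth_on S f \<longleftrightarrow> (\<forall>k. Ck_on k S f)"

definition partial :: "'n \<Rightarrow> (real^'n::finite \<Rightarrow> 'b::real_normed_vector) \<Rightarrow> real^'n \<Rightarrow> 'b" where
  "partial i f x = frechet_derivative f (at x) (axis i 1)"

section \<open>Smooth manifolds\<close>

text \<open>A manifold is given by an atlas on an open subset of a second countable Hausdorff type;
  its underlying set is the union of the chart domains.\<close>

type_synonym ('m, 'n) chart = "'m set \<times> ('m \<Rightarrow> real^'n)"

definition is_chart :: "('m::topological_space, 'n::finite) chart \<Rightarrow> bool" where
  "is_chart = (\<lambda>(U, \<phi>). open U \<and> open (\<phi> ` U) \<and> homeomorphism U (\<phi> ` U) \<phi> (inv_into U \<phi>))"

definition compatible :: "('m::topological_space, 'n::finite) chart \<Rightarrow> ('m, 'n) chart \<Rightarrow> bool" where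
  "compatible = (\<lambda>(U, \<phi>) (V, \<psi>).
     smooth_on (\<phi> ` (U \<inter> V)) (\<psi> \<circ> inv_into U \<phi>) \<and>
     smooth_on (\<psi> ` (U \<inter> V)) (\<phi> \<circ> inv_into V \<psi>))"

definition smooth_atlas ::
  "('m::{t2_space, second_countable_topology}, 'n::finite) chart set \<Rightarrow> bool" where
  "smooth_atlas \<A> \<longleftrightarrow> (\<forall>c\<in>\<A>. is_chart c) \<and> (\<forall>c\<in>\<A>. \<forall>d\<in>\<A>. compatible c d)"

definition points :: "('m, 'n) chart set \<Rightarrow> 'm set" where
  "points \<A> = \<Union> (fst ` \<A>)"

text \<open>Membership in the maximal atlas generated by \<open>\<A>\<close>.\<close>

definition local_coordinates ::
  "('m::topological_space, 'n::finite) chart set \<Rightarrow> ('m, 'n) chart \<Rightarrow> bool" where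
  "local_coordinates \<A> c \<longleftrightarrow>
     is_chart c \<and> fst c \<subseteq> points \<A> \<and> (\<forall>d\<in>\<A>. compatible c d)"

definition in_chart :: "('m, 'n) chart \<Rightarrow> ('m \<Rightarrow> 'b) \<Rightarrow> real^'n \<Rightarrow> 'b" where
  "in_chart = (\<lambda>(U, \<phi>) f. f \<circ> inv_into U \<phi>)"

definition image_of :: "('m, 'n) chart \<Rightarrow> (real^'n) set" where
  "image_of = (\<lambda>(U, \<phi>). \<phi> ` U)"

section \<open>Pseudo-Riemannian geometry in coordinates\<close>

text \<open>Coefficient matrices \<open>(g\<^sub>i\<^sub>j)\<close> of a \<open>(0,2)\<close>-tensor field on an open subset of \<open>\<real>\<^sup>n\<close>.\<close>

type_synonym 'n form_field = "real^'n \<Rightarrow> real^'n^'n"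

definition form :: "real^'n^'n::finite \<Rightarrow> real^'n \<Rightarrow> real^'n \<Rightarrow> real" where
  "form A v w = v \<bullet> (A *v w)"

text \<open>\<open>christoffel g x k i j\<close> is \<open>\<Gamma>\<^sup>k\<^sub>i\<^sub>j\<close> at \<open>x\<close>.\<close>

definition christoffel :: "'n::finite form_field \<Rightarrow> real^'n \<Rightarrow> 'n \<Rightarrow> 'n \<Rightarrow> 'n \<Rightarrow> real" where
  "christoffel g x k i j = 1/2 * (\<Sum>l\<in>UNIV. matrix_inv (g x) $ k $ l *
     (partial i (\<lambda>y. g y $ j $ l) x + partial j (\<lambda>y. g y $ i $ l) x
      - partial l (\<lambda>y. g y $ i $ j) x))"

definition isometry :: "(real^'n) set \<Rightarrow> 'n::finite form_field \<Rightarrow> (real^'n \<Rightarrow> real^'n) \<Rightarrow> bool" where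
  "isometry D g \<Phi> \<longleftrightarrow> bij_betw \<Phi> D D \<and> smooth_on D \<Phi> \<and> smooth_on D (inv_into D \<Phi>) \<and>
     (\<forall>x\<in>D. \<forall>v w. form (g (\<Phi> x)) (frechet_derivative \<Phi> (at x) v) (frechet_derivative \<Phi> (at x) w)
        = form (g x) v w)"

text \<open>In the following, \<open>G\<close> is an immersion expressed in a chart of its domain.\<close>

definition induced_metric :: "'n form_field \<Rightarrow> (real^'m \<Rightarrow> real^'n) \<Rightarrow> 'm::finite form_field" where
  "induced_metric g G u = (\<chi> i j. form (g (G u)) (partial i G u) (partial j G u))"

text \<open>The ambient derivative \<open>\<nabla>\<^bsub>\<partial>\<^sub>i\<^esub> G\<^sub>*\<partial>\<^sub>j\<close> along \<open>G\<close>.\<close>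

definition ambient_derivative ::
  "'n::finite form_field \<Rightarrow> (real^'m \<Rightarrow> real^'n) \<Rightarrow> real^'m::finite \<Rightarrow> 'm \<Rightarrow> 'm \<Rightarrow> real^'n" where
  "ambient_derivative g G u i j = partial i (partial j G) u +
     (\<chi> k. \<Sum>a\<in>UNIV. \<Sum>b\<in>UNIV. christoffel g (G u) k a b * partial i G u $ a * partial j G u $ b)"

text \<open>The image under \<open>G\<^sub>*\<close> of \<open>\<nabla>\<^sup>M\<^bsub>\<partial>\<^sub>i\<^esub> \<partial>\<^sub>j\<close>, for the Levi-Civita connection of the induced metric.\<close>

definition intrinsic_derivative ::
  "'n form_field \<Rightarrow> (real^'m \<Rightarrow> real^'n) \<Rightarrow> real^'m::finite \<Rightarrow> 'm \<Rightarrow> 'm \<Rightarrow> real^'n::finite" where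
  "intrinsic_derivative g G u i j =
     (\<Sum>l\<in>UNIV. christoffel (induced_metric g G) u l i j *\<^sub>R partial l G u)"

definition is_immersion_patch ::
  "(real^4) set \<Rightarrow> 4 form_field \<Rightarrow> (real^3) set \<Rightarrow> (real^3 \<Rightarrow> real^4) \<Rightarrow> bool" where
  "is_immersion_patch D g W G \<longleftrightarrow> G ` W \<subseteq> D \<and> smooth_on W G \<and>
     (\<forall>u\<in>W. inj (frechet_derivative G (at u)) \<and> invertible (induced_metric g G u))"

definition is_unit_normal ::
  "4 form_field \<Rightarrow> (real^3) set \<Rightarrow> (real^3 \<Rightarrow> real^4) \<Rightarrow> (real^3 \<Rightarrow> real^4) \<Rightarrow> bool" where
  "is_unit_normal g W G \<nu> \<longleftrightarrow> smooth_on W \<nu> \<and>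
     (\<forall>u\<in>W. form (g (G u)) (\<nu> u) (\<nu> u) \<in> {-1, 1} \<and>
        (\<forall>i. form (g (G u)) (partial i G u) (\<nu> u) = 0))"

text \<open>The Gauss formula for coordinate fields; it determines \<open>h\<close> because \<open>\<nu>\<close> is nowhere zero.\<close>

definition is_second_fundamental_form ::
  "4 form_field \<Rightarrow> (real^3) set \<Rightarrow> (real^3 \<Rightarrow> real^4) \<Rightarrow> (real^3 \<Rightarrow> real^4) \<Rightarrow> 3 form_field \<Rightarrow> bool" where
  "is_second_fundamental_form g W G \<nu> h \<longleftrightarrow>
     (\<forall>u\<in>W. \<forall>i j. h u $ i $ j = h u $ j $ i \<and>
        ambient_derivative g G u i j = intrinsic_derivative g G u i j + (h u $ i $ j) *\<^sub>R \<nu> u)"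

text \<open>A hypersurface \<open>F\<close> of \<open>(D, g)\<close> with unit normal \<open>\<xi>\<close>. The second fundamental form \<open>h\<close> is given by
  its components \<open>h c\<close> in each chart \<open>c\<close>; being determined by the Gauss formula in every chart, these
  are the components of one tensor field.\<close>

definition hypersurface ::
  "('m::{t2_space, second_countable_topology}, 3) chart set \<Rightarrow> (real^4) set \<Rightarrow> 4 form_field \<Rightarrow>
   ('m \<Rightarrow> real^4) \<Rightarrow> ('m \<Rightarrow> real^4) \<Rightarrow> (('m, 3) chart \<Rightarrow> 3 form_field) \<Rightarrow> bool" where
  "hypersurface \<A> D g F \<xi> h \<longleftrightarrow> smooth_atlas \<A> \<and>
     (\<forall>c\<in>\<A>. is_immersion_patch D g (image_of c) (in_chart c F) \<and>
        is_unit_normal g (image_of c) (in_chart c F) (in_chart c \<xi>) \<and>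
        is_second_fundamental_form g (image_of c) (in_chart c F) (in_chart c \<xi>) (h c))"

text \<open>The component \<open>(\<nabla>\<^sup>M h)(\<partial>\<^sub>i, \<partial>\<^sub>j, \<partial>\<^sub>k)\<close>, with respect to the metric \<open>\<gamma>\<close> of \<open>M\<close>.\<close>

definition covariant_derivative ::
  "'n::finite form_field \<Rightarrow> 'n form_field \<Rightarrow> real^'n \<Rightarrow> 'n \<Rightarrow> 'n \<Rightarrow> 'n \<Rightarrow> real" where
  "covariant_derivative \<gamma> h u i j k = partial i (\<lambda>v. h v $ j $ k) u
     - (\<Sum>l\<in>UNIV. christoffel \<gamma> u l i j * h u $ l $ k)
     - (\<Sum>l\<in>UNIV. christoffel \<gamma> u l i k * h u $ j $ l)"

definition codazzi ::
  "('m, 3) chart set \<Rightarrow> 4 form_field \<Rightarrow> ('m \<Rightarrow> real^4) \<Rightarrow> (('m, 3) chart \<Rightarrow> 3 form_field) \<Rightarrow> bool" where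
  "codazzi \<A> g F h \<longleftrightarrow> (\<forall>c\<in>\<A>. \<forall>u\<in>image_of c. \<forall>i j k.
     let T = covariant_derivative (induced_metric g (in_chart c F)) (h c) u
     in T i j k = T j i k \<and> T i j k = T i k j)"

definition mean_curvature :: "real^3^3 \<Rightarrow> real^3^3 \<Rightarrow> real" where
  "mean_curvature \<gamma> h = 1/3 * (\<Sum>i\<in>UNIV. \<Sum>j\<in>UNIV. matrix_inv \<gamma> $ i $ j * h $ i $ j)"

definition minimal ::
  "('m, 3) chart set \<Rightarrow> 4 form_field \<Rightarrow> ('m \<Rightarrow> real^4) \<Rightarrow> (('m, 3) chart \<Rightarrow> 3 form_field) \<Rightarrow> bool" where
  "minimal \<A> g F h \<longleftrightarrow> (\<forall>c\<in>\<A>. \<forall>u\<in>image_of c.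
     mean_curvature (induced_metric g (in_chart c F) u) (h c u) = 0)"

section \<open>Siklos spacetimes\<close>

text \<open>The defining function \<open>H(x\<^sub>2, x\<^sub>3, x\<^sub>4)\<close> as a function on spacetime.\<close>

definition on_spacetime :: "(real \<Rightarrow> real \<Rightarrow> real \<Rightarrow> real) \<Rightarrow> real^4 \<Rightarrow> real" where
  "on_spacetime H x = H (x$2) (x$3) (x$4)"

definition D2 :: "(real \<Rightarrow> real \<Rightarrow> real \<Rightarrow> real) \<Rightarrow> 4 \<Rightarrow> 4 \<Rightarrow> real^4 \<Rightarrow> real" where
  "D2 H i j = partial i (partial j (on_spacetime H))"

definition siklos_metric :: "real \<Rightarrow> (real \<Rightarrow> real \<Rightarrow> real \<Rightarrow> real) \<Rightarrow> 4 form_field" where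
  "siklos_metric \<beta> H x = (\<beta>\<^sup>2 / (x$3)\<^sup>2) *\<^sub>R vector
     [vector [0, 1, 0, 0],
      vector [1, on_spacetime H x, 0, 0],
      vector [0, 0, 1, 0],
      vector [0, 0, 0, 1]]"

text \<open>The spacetime is identified with the image \<open>D\<close> of its global coordinates.\<close>

definition siklos_spacetime ::
  "(real^4) set \<Rightarrow> real \<Rightarrow> real \<Rightarrow> (real \<Rightarrow> real \<Rightarrow> real \<Rightarrow> real) \<Rightarrow> bool" where
  "siklos_spacetime D \<Lambda> \<beta> H \<longleftrightarrow> open D \<and> (\<forall>x\<in>D. x$3 \<noteq> 0) \<and>
     \<Lambda> < 0 \<and> \<beta>\<^sup>2 = - 3 / \<Lambda> \<and> smooth_on D (on_spacetime H)"

definition graph_immersion :: "(real \<Rightarrow> real) \<Rightarrow> real^3 \<Rightarrow> real^4" where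
  "graph_immersion f u = vector [u$1, u$2, u$3, f (u$2)]"

text \<open>\<open>H''\<^sub>3\<^sub>4(u\<^sub>2, u\<^sub>3, f(u\<^sub>2)) = 0\<close> for \<open>u \<in> W\<close>; the first coordinate of the argument of \<open>D2 H 3 4\<close> is
  immaterial.\<close>

definition solves_functional_equation ::
  "(real \<Rightarrow> real \<Rightarrow> real \<Rightarrow> real) \<Rightarrow> (real^3) set \<Rightarrow> (real \<Rightarrow> real) \<Rightarrow> bool" where
  "solves_functional_equation H W f \<longleftrightarrow>
     smooth_on ((\<lambda>u. u$2) ` W) f \<and> (\<forall>u\<in>W. D2 H 3 4 (graph_immersion f u) = 0)"

end

theory Submission
  imports Defs
begin

text \<open>The normal lies in the span of \<open>\<partial>\<^sub>1\<close> and \<open>\<partial>\<^sub>4\<close>, so orthogonality says that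
  \<open>dx\<^sub>4\<close> is a multiple of \<open>dx\<^sub>2\<close> on \<open>M\<close>. Hence \<open>(x\<^sub>1, x\<^sub>2, x\<^sub>3)\<close> restricts to local coordinates of \<open>M\<close> in
  which \<open>x\<^sub>4\<close> depends on \<open>u\<^sub>2\<close> only, and the isometry \<open>\<Phi>\<close> can be taken to be the identity. The
  functional equation is the hypothesis on \<open>\<theta>\<close> at \<open>sin 2\<theta> = 0\<close>, \<open>cos 2\<theta> = -1\<close>. Minimality comes
  from a second fundamental form that is a multiple of \<open>dx\<^sub>2 \<otimes> dx\<^sub>2\<close>, where \<open>dx\<^sub>2\<close> is null on \<open>M\<close>.\<close>

subsection \<open>Calculus of smooth maps\<close>

lemma frechet_derivative_eqI:
  "(f has_derivative f') (at x) \<Longrightarrow> frechet_derivative f (at x) v = f' v"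
  by (drule frechet_derivative_at) simp

text \<open>Openness of \<open>S\<close> is what matters: the derivative at a point of
  \<open>S\<close> then depends only on values on \<open>S\<close>. The inductions below use this to
  replace a \<open>frechet_derivative\<close> by an explicit formula valid on \<open>S\<close>
  only.\<close>

lemma Ck_on_cong:
  assumes "open S" "\<And>x. x \<in> S \<Longrightarrow> f x = g x" "Ck_on k S f"
  shows "Ck_on k S g"
  using assms(2,3)
proof (induction k arbitrary: f g)
  case 0
  then show ?case by (simp cong: continuous_on_cong)
next
  case (Suc k)
  have diff: "g differentiable at x" if "x \<in> S" for x
    using Suc.prems \<open>open S\<close> that
    unfolding differentiable_def by (metis Ck_on.simps(2) differentiable_def has_derivative_transform_within_open)
  have "Ck_on k S (\<lambda>x. frechet_derivative g (at x) v)" for v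
  proof (rule Suc.IH)
    show "Ck_on k S (\<lambda>x. frechet_derivative f (at x) v)"
      using Suc.prems by simp
    show "frechet_derivative f (at x) v = frechet_derivative g (at x) v" if "x \<in> S" for x
      using frechet_derivative_transform_within_open[of f x S g] Suc.prems \<open>open S\<close> that by simp
  qed
  then show ?case using diff by simp
qed

lemma Ck_on_subset: "Ck_on k T f \<Longrightarrow> S \<subseteq> T \<Longrightarrow> Ck_on k S f"
  by (induction k arbitrary: f) (auto intro: continuous_on_subset)

lemma Ck_on_Suc_D: "Ck_on (Suc k) S f \<Longrightarrow> Ck_on k S f"
proof (induction k arbitrary: f)
  case 0
  then show ?case
    by (auto intro!: continuous_at_imp_continuous_on differentiable_imp_continuous_within)
qed auto

lemma Ck_on_const: "Ck_on k S (\<lambda>x. c)"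
  by (induction k arbitrary: c) auto

lemma Ck_on_ident: "Ck_on k S (\<lambda>x. x)"
  by (cases k) (auto intro: Ck_on_const)

lemma Ck_on_add:
  assumes "open S" "Ck_on k S f" "Ck_on k S g"
  shows "Ck_on k S (\<lambda>x. f x + g x)"
  using assms(2,3)
proof (induction k arbitrary: f g)
  case 0
  then show ?case by (auto intro: continuous_intros)
next
  case (Suc k)
  have *: "Ck_on k S (\<lambda>x. frechet_derivative (\<lambda>x. f x + g x) (at x) v)" for v
  proof (rule Ck_on_cong[OF \<open>open S\<close>])
    show "Ck_on k S (\<lambda>x. frechet_derivative f (at x) v + frechet_derivative g (at x) v)"
      using Suc by simp
    fix x assume "x \<in> S"
    then have "f differentiable at x" "g differentiable at x"
      using Suc by auto
    then have "((\<lambda>x. f x + g x) has_derivative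
        (\<lambda>v. frechet_derivative f (at x) v + frechet_derivative g (at x) v)) (at x)"
      by (auto intro: derivative_intros simp: frechet_derivative_works[symmetric])
    then show "frechet_derivative f (at x) v + frechet_derivative g (at x) v
        = frechet_derivative (\<lambda>x. f x + g x) (at x) v"
      by (rule frechet_derivative_eqI[symmetric])
  qed
  then show ?case using Suc.prems by (auto intro: differentiable_add)
qed

lemma Ck_on_sum:
  assumes "open S" "\<And>i. i \<in> I \<Longrightarrow> Ck_on k S (f i)"
  shows "Ck_on k S (\<lambda>x. \<Sum>i\<in>I. f i x)"
  using assms(2)
  by (induction I rule: infinite_finite_induct) (auto intro: Ck_on_const Ck_on_add[OF \<open>open S\<close>])

lemma Ck_on_bounded_linear:
  assumes "open S" "bounded_linear L" "Ck_on k S f"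
  shows "Ck_on k S (\<lambda>x. L (f x))"
  using assms(3)
proof (induction k arbitrary: f)
  case 0
  then show ?case
    using bounded_linear.continuous_on[OF assms(2)] by simp
next
  case (Suc k)
  have der: "((\<lambda>x. L (f x)) has_derivative (\<lambda>v. L (frechet_derivative f (at x) v))) (at x)"
    if "x \<in> S" for x
    using Suc.prems that
    by (auto intro!: bounded_linear.has_derivative[OF assms(2)] simp: frechet_derivative_works[symmetric])
  have "Ck_on k S (\<lambda>x. frechet_derivative (\<lambda>x. L (f x)) (at x) v)" for v
  proof (rule Ck_on_cong[OF \<open>open S\<close>])
    show "Ck_on k S (\<lambda>x. L (frechet_derivative f (at x) v))"
      using Suc by simp
    show "L (frechet_derivative f (at x) v) = frechet_derivative (\<lambda>x. L (f x)) (at x) v" if "x \<in> S" for x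
      using frechet_derivative_eqI[OF der[OF that]] by simp
  qed
  moreover have "\<forall>x\<in>S. (\<lambda>x. L (f x)) differentiable at x"
    using der differentiableI by blast
  ultimately show ?case by simp
qed

lemma Ck_on_scaleR:
  fixes f :: "'a::euclidean_space \<Rightarrow> real"
  assumes "open S" "Ck_on k S f" "Ck_on k S g"
  shows "Ck_on k S (\<lambda>x. f x *\<^sub>R g x)"
  using assms(2,3)
proof (induction k arbitrary: f g)
  case 0
  then show ?case by (auto intro: continuous_intros)
next
  case (Suc k)
  have der: "((\<lambda>x. f x *\<^sub>R g x) has_derivative
      (\<lambda>v. f x *\<^sub>R frechet_derivative g (at x) v + frechet_derivative f (at x) v *\<^sub>R g x)) (at x)"
    if "x \<in> S" for x
    using Suc.prems that
    by (auto intro!: has_derivative_scaleR simp: frechet_derivative_works[symmetric])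
  have "Ck_on k S (\<lambda>x. frechet_derivative (\<lambda>x. f x *\<^sub>R g x) (at x) v)" for v
  proof (rule Ck_on_cong[OF \<open>open S\<close>])
    show "Ck_on k S (\<lambda>x. f x *\<^sub>R frechet_derivative g (at x) v + frechet_derivative f (at x) v *\<^sub>R g x)"
      \<comment> \<open>The Leibniz formula also contains \<open>f\<close> and \<open>g\<close>
        undifferentiated, so their regularity has to be lowered by one order before the induction
        hypothesis applies.\<close>
      using Suc.prems by (auto intro!: Ck_on_add[OF \<open>open S\<close>] Suc.IH intro: Ck_on_Suc_D)
    show "f x *\<^sub>R frechet_derivative g (at x) v + frechet_derivative f (at x) v *\<^sub>R g x
        = frechet_derivative (\<lambda>x. f x *\<^sub>R g x) (at x) v" if "x \<in> S" for x
      using frechet_derivative_eqI[OF der[OF that]] by simp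
  qed
  moreover have "\<forall>x\<in>S. (\<lambda>x. f x *\<^sub>R g x) differentiable at x"
    using der differentiableI by blast
  ultimately show ?case by simp
qed

lemma Ck_on_prod:
  fixes f :: "'i \<Rightarrow> 'a::euclidean_space \<Rightarrow> real"
  assumes "open S" "\<And>i. i \<in> I \<Longrightarrow> Ck_on k S (f i)"
  shows "Ck_on k S (\<lambda>x. \<Prod>i\<in>I. f i x)"
  using assms(2)
proof (induction I rule: infinite_finite_induct)
  case (insert i I)
  then show ?case
    using Ck_on_scaleR[OF \<open>open S\<close>, of k "f i" "\<lambda>x. \<Prod>i\<in>I. f i x"] by simp
qed (auto intro: Ck_on_const)

text \<open>Bootstrapping: the derivative of 1/f is -(1/f)^2 times that of f, so it is C^k as soon
  as 1/f itself is, which is the induction hypothesis.\<close>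

lemma Ck_on_inverse:
  fixes f :: "'a::euclidean_space \<Rightarrow> real"
  assumes "open S" "\<And>x. x \<in> S \<Longrightarrow> f x \<noteq> 0" "Ck_on k S f"
  shows "Ck_on k S (\<lambda>x. inverse (f x))"
  using assms(3)
proof (induction k)
  case 0
  then show ?case using assms(2) by (auto intro: continuous_intros)
next
  case (Suc k)
  have der: "((\<lambda>x. inverse (f x)) has_derivative
      (\<lambda>v. - (inverse (f x) * frechet_derivative f (at x) v * inverse (f x)))) (at x)"
    if "x \<in> S" for x
    using Suc.prems that assms(2)
    by (auto intro!: has_derivative_inverse simp: frechet_derivative_works[symmetric])
  have "Ck_on k S (\<lambda>x. frechet_derivative (\<lambda>x. inverse (f x)) (at x) v)" for v
  proof (rule Ck_on_cong[OF \<open>open S\<close>])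
    have inv: "Ck_on k S (\<lambda>x. inverse (f x))"
      using Suc Ck_on_Suc_D by blast
    then show "Ck_on k S (\<lambda>x. (- 1) *\<^sub>R inverse (f x) *\<^sub>R inverse (f x) *\<^sub>R frechet_derivative f (at x) v)"
      using Suc.prems by (intro Ck_on_scaleR[OF \<open>open S\<close>] Ck_on_const) auto
    show "(- 1) *\<^sub>R inverse (f x) *\<^sub>R inverse (f x) *\<^sub>R frechet_derivative f (at x) v
        = frechet_derivative (\<lambda>x. inverse (f x)) (at x) v" if "x \<in> S" for x
      using frechet_derivative_eqI[OF der[OF that]] by simp
  qed
  moreover have "\<forall>x\<in>S. (\<lambda>x. inverse (f x)) differentiable at x"
    using der differentiableI by blast
  ultimately show ?case by simp
qed

text \<open>By the chain rule the derivative is Dg at f(x) applied to a direction that varies with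
  x. Expanding this direction in \<open>Basis\<close> leaves derivatives of \<open>g\<close> in
  fixed directions composed with \<open>f\<close>, to which the induction hypothesis applies; hence
  \<open>g\<close> is arbitrary in the induction and \<open>f\<close> is fixed.\<close>

lemma Ck_on_compose:
  fixes g :: "'b::euclidean_space \<Rightarrow> 'c::real_normed_vector"
  assumes "open S" "f ` S \<subseteq> T" "Ck_on k S f" "Ck_on k T g"
  shows "Ck_on k S (g \<circ> f)"
  using assms(3,4)
proof (induction k arbitrary: g)
  case 0
  then show ?case using assms(2) by (simp add: continuous_on_compose continuous_on_subset del: o_apply)
next
  case (Suc k)
  have der: "((g \<circ> f) has_derivative
      (\<lambda>v. frechet_derivative g (at (f x)) (frechet_derivative f (at x) v))) (at x)"
    if "x \<in> S" for x
  proof -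
    have "f differentiable at x" "g differentiable at (f x)"
      using Suc.prems that assms(2) by auto
    then show ?thesis
      using diff_chain_at[of f "frechet_derivative f (at x)" x g "frechet_derivative g (at (f x))"]
      by (simp add: frechet_derivative_works comp_def)
  qed
  have "Ck_on k S (\<lambda>x. frechet_derivative (g \<circ> f) (at x) v)" for v
  proof (rule Ck_on_cong[OF \<open>open S\<close>])
    have "Ck_on k S (\<lambda>x. frechet_derivative g (at (f x)) b)" for b
      using Suc.IH[of "\<lambda>y. frechet_derivative g (at y) b"] Suc.prems Ck_on_Suc_D
      by (auto simp: comp_def)
    moreover have "Ck_on k S (\<lambda>x. frechet_derivative f (at x) v \<bullet> b)" for b
      using Suc.prems by (intro Ck_on_bounded_linear[OF \<open>open S\<close> bounded_linear_inner_left]) auto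
    ultimately show "Ck_on k S (\<lambda>x. \<Sum>b\<in>Basis. (frechet_derivative f (at x) v \<bullet> b) *\<^sub>R
        frechet_derivative g (at (f x)) b)"
      by (intro Ck_on_sum Ck_on_scaleR \<open>open S\<close>)
    fix x assume x: "x \<in> S"
    have lin: "linear (frechet_derivative g (at (f x)))"
      using Suc.prems x assms(2) by (intro linear_frechet_derivative) auto
    have "frechet_derivative (g \<circ> f) (at x) v
        = frechet_derivative g (at (f x)) (\<Sum>b\<in>Basis. (frechet_derivative f (at x) v \<bullet> b) *\<^sub>R b)"
      using frechet_derivative_eqI[OF der[OF x]] by (simp add: euclidean_representation)
    then show "(\<Sum>b\<in>Basis. (frechet_derivative f (at x) v \<bullet> b) *\<^sub>R frechet_derivative g (at (f x)) b)
        = frechet_derivative (g \<circ> f) (at x) v"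
      by (simp add: linear_sum[OF lin] linear_cmul[OF lin])
  qed
  moreover have "\<forall>x\<in>S. (g \<circ> f) differentiable at x"
    using der differentiableI by blast
  ultimately show ?case by (simp del: o_apply)
qed

lemma Ck_on_vec_lambda:
  assumes "open S" "\<And>i. Ck_on k S (f i)"
  shows "Ck_on k S (\<lambda>x. (\<chi> i. f i x) :: real^'n::finite)"
proof (rule Ck_on_cong[OF \<open>open S\<close>])
  show "Ck_on k S (\<lambda>x. \<Sum>i\<in>UNIV. f i x *\<^sub>R axis i (1::real))"
    by (intro Ck_on_sum Ck_on_scaleR Ck_on_const assms)
  show "(\<Sum>i\<in>UNIV. f i x *\<^sub>R axis i 1) = (\<chi> i. f i x)" for x
    by (simp add: vec_eq_iff axis_def if_distrib cong: if_cong)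
qed

lemma Ck_on_det:
  fixes A :: "'a::euclidean_space \<Rightarrow> real^'n::finite^'n"
  assumes "open S" "\<And>i j. Ck_on k S (\<lambda>x. A x $ i $ j)"
  shows "Ck_on k S (\<lambda>x. det (A x))"
proof -
  have "Ck_on k S (\<lambda>x. \<Sum>p | p permutes (UNIV::'n set).
      real_of_int (sign p) *\<^sub>R (\<Prod>i\<in>UNIV. A x $ i $ p i))"
    by (intro Ck_on_sum Ck_on_scaleR Ck_on_prod Ck_on_const assms)
  then show ?thesis by (simp add: det_def)
qed

section \<open>Passage from C^k to smooth maps\<close>

lemma smooth_on_cong:
  "open S \<Longrightarrow> (\<And>x. x \<in> S \<Longrightarrow> f x = g x) \<Longrightarrow> smooth_on S f \<Longrightarrow> smooth_on S g"
  unfolding smooth_on_def using Ck_on_cong by blast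

lemma smooth_on_subset: "smooth_on T f \<Longrightarrow> S \<subseteq> T \<Longrightarrow> smooth_on S f"
  unfolding smooth_on_def using Ck_on_subset by blast

lemma smooth_on_ident: "smooth_on S (\<lambda>x. x)"
  unfolding smooth_on_def using Ck_on_ident by blast

lemma smooth_on_compose:
  fixes g :: "'b::euclidean_space \<Rightarrow> 'c::real_normed_vector"
  shows "open S \<Longrightarrow> f ` S \<subseteq> T \<Longrightarrow> smooth_on S f \<Longrightarrow> smooth_on T g \<Longrightarrow> smooth_on S (g \<circ> f)"
  unfolding smooth_on_def using Ck_on_compose by blast

lemma smooth_on_nth:
  fixes f :: "'a::euclidean_space \<Rightarrow> real^'n::finite"
  shows "open S \<Longrightarrow> smooth_on S f \<Longrightarrow> smooth_on S (\<lambda>x. f x $ i)"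
  unfolding smooth_on_def
  using Ck_on_bounded_linear[OF _ bounded_linear_vec_nth] by blast

lemma smooth_on_imp_has_derivative:
  assumes "smooth_on S f" "x \<in> S"
  shows "(f has_derivative frechet_derivative f (at x)) (at x)"
  using assms frechet_derivative_works unfolding smooth_on_def by (metis Ck_on.simps(2))

lemma smooth_on_imp_continuous_on: "smooth_on S f \<Longrightarrow> continuous_on S f"
  unfolding smooth_on_def by (metis Ck_on.simps(1))

lemma smooth_on_frechet_derivative:
  "smooth_on S f \<Longrightarrow> smooth_on S (\<lambda>x. frechet_derivative f (at x) v)"
  unfolding smooth_on_def by (metis Ck_on.simps(2))

section \<open>The inverse function theorem for smooth maps\<close>

text \<open>The derivative of \<open>g\<close> solves a linear system with coefficients \<open>Df \<circ> g\<close>, so by Cramer's rule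
  it is as smooth as \<open>g\<close> itself.\<close>

lemma smooth_on_right_inverse:
  fixes f g :: "real^'n::finite \<Rightarrow> real^'n"
  assumes "open T" "smooth_on S f" "g ` T \<subseteq> S"
    and fg: "\<And>y. y \<in> T \<Longrightarrow> f (g y) = y"
    and diff: "\<And>y. y \<in> T \<Longrightarrow> g differentiable at y"
  shows "smooth_on T g"
proof -
  define Df where "Df x = frechet_derivative f (at x)" for x
  define Dg where "Dg y = frechet_derivative g (at y)" for y
  define J where "J y = matrix (Df (g y))" for y
  have Df: "(f has_derivative Df (g y)) (at (g y))" and Dg: "(g has_derivative Dg y) (at y)"
    if "y \<in> T" for y
    using smooth_on_imp_has_derivative[OF assms(2)] diff assms(3) that
    unfolding Df_def Dg_def frechet_derivative_works by blast+
  have inv: "Df (g y) (Dg y v) = v" if "y \<in> T" for y v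
  proof -
    have "((f \<circ> g) has_derivative (Df (g y) \<circ> Dg y)) (at y)"
      using Df Dg that by (auto intro: diff_chain_at)
    moreover have "((f \<circ> g) has_derivative (\<lambda>v. v)) (at y)"
      by (rule has_derivative_transform_within_open[OF has_derivative_ident \<open>open T\<close> that])
        (simp add: fg)
    ultimately have "Df (g y) \<circ> Dg y = (\<lambda>v. v)"
      by (rule has_derivative_unique)
    then show ?thesis by (auto dest: fun_cong[of _ _ v])
  qed
  have mult: "J y *v v = Df (g y) v" if "y \<in> T" for y v
    unfolding J_def by (rule fun_cong[OF matrix_vector_mul(2)[OF has_derivative_linear[OF Df[OF that]]]])
  \<comment> \<open>The matrix of the derivative of \<open>g\<close> is a right inverse of
    \<open>J y\<close>, because f(g(y)) = y was differentiated above.\<close>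
  have det: "det (J y) \<noteq> 0" if "y \<in> T" for y
  proof -
    have "matrix (Dg y) *v v = Dg y v" for v
      by (rule fun_cong[OF matrix_vector_mul(2)[OF has_derivative_linear[OF Dg[OF that]]]])
    then have "J y *v (matrix (Dg y) *v v) = v" for v
      using inv mult that by metis
    then have "J y ** matrix (Dg y) = mat 1"
      unfolding matrix_eq by (simp add: matrix_vector_mul_assoc)
    then show ?thesis
      using invertible_det_nz[of "J y"] invertible_right_inverse[of "J y"] by blast
  qed
  have solve: "Dg y v = (\<chi> k. inverse (det (J y)) *\<^sub>R det (\<chi> i j. if j = k then v $ i else J y $ i $ j))"
    if "y \<in> T" for y v
  proof -
    have "J y *v Dg y v = v" using mult inv that by simp
    then have "Dg y v = (\<chi> k. det (\<chi> i j. if j = k then v $ i else J y $ i $ j) / det (J y))"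
      by (rule iffD1[OF cramer[OF det[OF that]]])
    then show ?thesis by (simp only: divide_inverse mult.commute real_scaleR_def)
  qed
  have "Ck_on k T g" for k
  proof (induction k)
    case 0
    then show ?case
      using diff by (auto intro!: continuous_at_imp_continuous_on differentiable_imp_continuous_within)
  next
    case (Suc k)
    have J: "Ck_on k T (\<lambda>y. J y $ i $ j)" for i j
    proof -
      have "Ck_on k S (\<lambda>x. Df x (axis j 1))"
        using smooth_on_frechet_derivative[OF assms(2)] unfolding Df_def smooth_on_def by blast
      from Ck_on_compose[OF \<open>open T\<close> assms(3) Suc this]
      show ?thesis
        unfolding J_def matrix_def
        using Ck_on_bounded_linear[OF \<open>open T\<close> bounded_linear_vec_nth] by (auto simp: comp_def)
    qed
    have "Ck_on k T (\<lambda>y. Dg y v)" for v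
    proof (rule Ck_on_cong[OF \<open>open T\<close>])
      have "Ck_on k T (\<lambda>y. if j = l then v $ i else J y $ i $ j)" for i j l
        using J Ck_on_const by (cases "j = l") auto
      then show "Ck_on k T (\<lambda>y. \<chi> k. inverse (det (J y)) *\<^sub>R det (\<chi> i j. if j = k then v $ i else J y $ i $ j))"
        using J by (intro Ck_on_vec_lambda Ck_on_scaleR Ck_on_inverse Ck_on_det det \<open>open T\<close>) auto
    qed (simp add: solve)
    then show ?case using diff unfolding Dg_def by simp
  qed
  then show ?thesis unfolding smooth_on_def by blast
qed

text \<open>The classical theorem supplies a differentiable local inverse, and
  \<open>smooth_on_right_inverse\<close> upgrades it to a smooth one. An injective linear map has a
  linear left inverse, which is the form of invertibility that the classical theorem
  requires.\<close>

theorem smooth_inverse_function: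
  fixes f :: "real^'n::finite \<Rightarrow> real^'n"
  assumes "open S" "smooth_on S f" "x \<in> S" "inj (frechet_derivative f (at x))"
  obtains U V g where "open U" "U \<subseteq> S" "x \<in> U" "open V" "homeomorphism U V f g" "smooth_on V g"
proof -
  \<comment> \<open>The derivative must be continuous in operator norm, so it is packaged as a
    bounded linear map; in finite dimension continuity can be checked one direction at a
    time.\<close>
  define f' where "f' y = Blinfun (frechet_derivative f (at y))" for y
  have app: "blinfun_apply (f' y) = frechet_derivative f (at y)" if "y \<in> S" for y
    unfolding f'_def using smooth_on_imp_has_derivative[OF assms(2) that]
    by (auto intro: bounded_linear_Blinfun_apply has_derivative_bounded_linear)
  have der: "(f has_derivative blinfun_apply (f' y)) (at y)" if "y \<in> S" for y
    using smooth_on_imp_has_derivative[OF assms(2)] app that by simp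
  have cont: "continuous_on S f'"
  proof (rule continuous_on_blinfun_componentwise)
    show "continuous_on S (\<lambda>y. blinfun_apply (f' y) b)" for b
      using smooth_on_imp_continuous_on[OF smooth_on_frechet_derivative[OF assms(2), of b]]
      by (auto simp: app cong: continuous_on_cong)
  qed
  obtain h where h: "linear h" "h \<circ> frechet_derivative f (at x) = id"
    using linear_injective_left_inverse[of "frechet_derivative f (at x)"] assms
      has_derivative_linear[OF smooth_on_imp_has_derivative[OF assms(2,3)]] by blast
  have "Blinfun h o\<^sub>L f' x = id_blinfun"
  proof (rule blinfun_eqI)
    fix v
    have "h (frechet_derivative f (at x) v) = v"
      using h(2) by (metis comp_apply id_apply)
    then show "blinfun_apply (Blinfun h o\<^sub>L f' x) v = blinfun_apply id_blinfun v"
      using app[OF assms(3)] bounded_linear_Blinfun_apply[of h] h(1)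
      by (simp add: linear_conv_bounded_linear)
  qed
  from inverse_function_theorem[OF assms(1) der cont assms(3) this]
  obtain U V g g' where *: "open U" "U \<subseteq> S" "x \<in> U" "open V" "homeomorphism U V f g"
    "\<And>y. y \<in> V \<Longrightarrow> (g has_derivative g' y) (at y)" by metis
  have "smooth_on V g"
  proof (rule smooth_on_right_inverse)
    show "open V" by fact
    show "smooth_on U f" using smooth_on_subset assms(2) *(2) by blast
    show "g ` V \<subseteq> U" "\<And>y. y \<in> V \<Longrightarrow> f (g y) = y"
      using *(5) by (auto simp: homeomorphism_def)
    show "g differentiable at y" if "y \<in> V" for y
      using *(6) that unfolding differentiable_def by blast
  qed
  with * that show thesis by blast
qed

subsection \<open>Hypersurfaces of Siklos spacetimes\<close>

lemma vector_4 [simp]: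
  "(vector [x,y,z,w] :: 'a::zero^4)$1 = x"
  "(vector [x,y,z,w] :: 'a::zero^4)$2 = y"
  "(vector [x,y,z,w] :: 'a::zero^4)$3 = z"
  "(vector [x,y,z,w] :: 'a::zero^4)$4 = w"
  unfolding vector_def by simp_all

lemma vec_eq_iff_4: "x = y \<longleftrightarrow> x $ 1 = y $ 1 \<and> x $ 2 = y $ 2 \<and> x $ 3 = y $ 3 \<and> x $ 4 = y $ (4::4)"
  unfolding vec_eq_iff forall_4 ..

text \<open>A directional derivative is read off from the restriction to a line. This serves maps
  that are affine in one direction: the defining function along x_1, and graph immersions along u_1
  and u_3.\<close>

lemma frechet_derivative_along_line:
  fixes f :: "'a::real_normed_vector \<Rightarrow> 'b::real_normed_vector"
  assumes "f differentiable at x" "open S" "x \<in> S"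
    and line: "\<And>t. x + t *\<^sub>R v \<in> S \<Longrightarrow> f (x + t *\<^sub>R v) = f x + t *\<^sub>R w"
  shows "frechet_derivative f (at x) v = w"
proof -
  let ?l = "\<lambda>t::real. x + t *\<^sub>R v"
  have "(?l has_derivative (\<lambda>t. t *\<^sub>R v)) (at 0)"
    by (auto intro!: derivative_eq_intros)
  moreover have "(f has_derivative frechet_derivative f (at x)) (at (?l 0))"
    using assms(1) by (simp add: frechet_derivative_works)
  ultimately have 1: "((f \<circ> ?l) has_derivative (frechet_derivative f (at x) \<circ> (\<lambda>t. t *\<^sub>R v))) (at 0)"
    by (rule diff_chain_at)
  have "open (?l -` S)"
    using \<open>open S\<close> by (intro open_vimage) (auto intro!: continuous_intros)
  then have 2: "((f \<circ> ?l) has_derivative (\<lambda>t. t *\<^sub>R w)) (at 0)"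
    by (rule has_derivative_transform_within_open[rotated])
      (use assms(3) line in \<open>auto intro!: derivative_eq_intros\<close>)
  show ?thesis
    using fun_cong[OF has_derivative_unique[OF 1 2], of 1] by simp
qed

lemma frechet_derivative_expand:
  fixes f :: "real^'n::finite \<Rightarrow> 'b::real_normed_vector"
  assumes "f differentiable at x"
  shows "frechet_derivative f (at x) v = (\<Sum>i\<in>UNIV. v $ i *\<^sub>R partial i f x)"
proof -
  have lin: "linear (frechet_derivative f (at x))"
    using assms by (rule linear_frechet_derivative)
  have "frechet_derivative f (at x) v = frechet_derivative f (at x) (\<Sum>i\<in>UNIV. v $ i *\<^sub>R axis i 1)"
    by (simp add: basis_expansion[of v, unfolded scalar_mult_eq_scaleR])
  then show ?thesis
    by (simp add: partial_def linear_sum[OF lin] linear_cmul[OF lin])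
qed

section \<open>The Siklos metric, its inverse and its Christoffel symbols\<close>

lemma form_siklos:
  "form (siklos_metric \<beta> H x) v w =
     \<beta>\<^sup>2 / (x$3)\<^sup>2 * (v$1 * w$2 + v$2 * w$1 + on_spacetime H x * v$2 * w$2 + v$3 * w$3 + v$4 * w$4)"
  unfolding form_def siklos_metric_def
  by (simp add: inner_vec_def matrix_vector_mult_def sum_4 algebra_simps)

lemma matrix_inv_eqI:
  fixes A B :: "real^'n::finite^'n"
  assumes "A ** B = mat 1"
  shows "matrix_inv A = B"
proof -
  have "B ** A = mat 1"
    using assms by (simp add: matrix_left_right_inverse)
  then show ?thesis
    unfolding matrix_inv_def
    using assms by (intro some_equality) (auto, metis matrix_mul_assoc matrix_mul_lid matrix_mul_rid)
qed

lemma matrix_inv_siklos: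
  assumes "x$3 \<noteq> 0" "\<beta> \<noteq> 0"
  shows "matrix_inv (siklos_metric \<beta> H x) = ((x$3)\<^sup>2 / \<beta>\<^sup>2) *\<^sub>R vector
     [vector [- on_spacetime H x, 1, 0, 0],
      vector [1, 0, 0, 0],
      vector [0, 0, 1, 0],
      vector [0, 0, 0, 1]]"
  using assms unfolding siklos_metric_def
  by (intro matrix_inv_eqI)
    (simp add: vec_eq_iff forall_4 matrix_matrix_mult_def sum_4 mat_def)

lemma siklos_metric_nth:
  "siklos_metric \<beta> H x $ j $ l = \<beta>\<^sup>2 / (x$3)\<^sup>2 *
     (if j = 2 \<and> l = 2 then on_spacetime H x
      else if (j, l) \<in> {(1, 2), (2, 1), (3, 3), (4, 4)} then 1 else 0)"
  using exhaust_4[of j] exhaust_4[of l] unfolding siklos_metric_def by auto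

text \<open>Product rule: the conformal factor depends on x_3 alone and contributes the first
  summand; of the remaining matrix only the (2,2) entry varies, which gives the second.\<close>

lemma partial_siklos_metric:
  assumes "x$3 \<noteq> 0" "on_spacetime H differentiable at x"
  shows "partial i (\<lambda>y. siklos_metric \<beta> H y $ j $ l) x =
     (if i = 3 then - 2 / x$3 * siklos_metric \<beta> H x $ j $ l else 0) +
     (if j = 2 \<and> l = 2 then \<beta>\<^sup>2 / (x$3)\<^sup>2 * partial i (on_spacetime H) x else 0)"
proof -
  define H' where "H' = frechet_derivative (on_spacetime H) (at x)"
  define c :: real where "c = (if (j, l) \<in> {(1, 2), (2, 1), (3, 3), (4, 4)} then 1 else 0)"
  have H: "(on_spacetime H has_derivative H') (at x)"
    using assms(2) unfolding H'_def frechet_derivative_works .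
  have q: "((\<lambda>y. if j = 2 \<and> l = 2 then on_spacetime H y else c) has_derivative
      (\<lambda>v. if j = 2 \<and> l = 2 then H' v else 0)) (at x)"
    using H by (cases "j = 2"; cases "l = 2") simp_all
  have s: "((\<lambda>y. \<beta>\<^sup>2 / (y$3)\<^sup>2) has_derivative (\<lambda>v. - 2 / x$3 * (\<beta>\<^sup>2 / (x$3)\<^sup>2) * v$3)) (at x)"
    using assms(1)
    by (auto intro!: derivative_eq_intros bounded_linear.has_derivative[OF bounded_linear_vec_nth]
        simp: fun_eq_iff field_simps power2_eq_square)
  from frechet_derivative_eqI[OF has_derivative_mult[OF s q], of "axis i 1"]
  show ?thesis
    unfolding partial_def siklos_metric_nth c_def[symmetric] H'_def[symmetric]
    by (simp add: axis_def)
qed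

lemma partial_1_on_spacetime:
  assumes "on_spacetime H differentiable at x"
  shows "partial 1 (on_spacetime H) x = 0"
  unfolding partial_def using assms
  by (rule frechet_derivative_along_line[where S = UNIV]) (auto simp: on_spacetime_def axis_def)

text \<open>Row 2 of the inverse metric has its only nonzero entry in column 1, and H does not
  depend on x_1, so only the conformal factor contributes. Upper indices 2 and 4 suffice below,
  because the metric pairing with a combination of \<partial>_1 and \<partial>_4 sees only
  components 2 and 4.\<close>

lemma christoffel_siklos_2:
  assumes "x$3 \<noteq> 0" "\<beta> \<noteq> 0" "on_spacetime H differentiable at x"
  shows "christoffel (siklos_metric \<beta> H) x 2 a b =
    - (1 / x$3) * (if (a, b) \<in> {(2, 3), (3, 2)} then 1 else 0)"
  unfolding christoffel_def partial_siklos_metric[OF assms(1,3)]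
  using assms exhaust_4[of a] exhaust_4[of b]
  by (auto simp: sum_4 matrix_inv_siklos partial_1_on_spacetime siklos_metric_nth)

lemma christoffel_siklos_4:
  assumes "x$3 \<noteq> 0" "\<beta> \<noteq> 0" "on_spacetime H differentiable at x"
  shows "christoffel (siklos_metric \<beta> H) x 4 a b =
    - (1 / x$3) * (if (a, b) \<in> {(4, 3), (3, 4)} then 1 else 0)
    - 1/2 * (if a = 2 \<and> b = 2 then partial 4 (on_spacetime H) x else 0)"
  unfolding christoffel_def partial_siklos_metric[OF assms(1,3)]
  using assms exhaust_4[of a] exhaust_4[of b]
  by (auto simp: sum_4 matrix_inv_siklos siklos_metric_nth)

lemma siklos_spacetime_nonzero:
  assumes "siklos_spacetime D \<Lambda> \<beta> H" "x \<in> D"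
  shows "\<beta> \<noteq> 0" "x$3 \<noteq> 0" "on_spacetime H differentiable at x"
proof -
  have "\<beta>\<^sup>2 > 0"
    using assms(1) unfolding siklos_spacetime_def by (metis neg_0_less_iff_less zero_less_numeral divide_neg_neg neg_less_0_iff_less)
  then show "\<beta> \<noteq> 0" by auto
  show "x$3 \<noteq> 0" using assms unfolding siklos_spacetime_def by auto
  have "smooth_on D (on_spacetime H)"
    using assms(1) unfolding siklos_spacetime_def by auto
  then show "on_spacetime H differentiable at x"
    using smooth_on_imp_has_derivative assms(2) differentiableI by blast
qed

section \<open>Vanishing of the mean curvature at a point\<close>

text \<open>Let \<open>\<nu>\<close> be spanned by \<open>\<partial>\<^sub>1\<close> and \<open>\<partial>\<^sub>4\<close>. Differentiating the orthogonality relation eliminates the second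
  derivatives of \<open>G\<close> from the Gauss formula and leaves \<open>h = q \<otimes> dx\<^sub>2\<close>. The null field \<open>\<partial>\<^sub>1\<close> is tangent and
  metrically dual to \<open>dx\<^sub>2\<close> up to a factor, so the trace of \<open>h\<close> is a multiple of \<open>q(\<partial>\<^sub>1)\<close>, which vanishes
  because \<open>q \<otimes> dx\<^sub>2\<close> is symmetric and \<open>dx\<^sub>2(\<partial>\<^sub>1) = 0\<close>.\<close>

lemma mean_curvature_eq_0:
  assumes sik: "siklos_spacetime D \<Lambda> \<beta> H"
    and W: "open W" "u \<in> W"
    and imm: "is_immersion_patch D (siklos_metric \<beta> H) W G"
    and nor: "is_unit_normal (siklos_metric \<beta> H) W G \<nu>"
    and sff: "is_second_fundamental_form (siklos_metric \<beta> H) W G \<nu> h"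
    and \<nu>: "\<And>v. v \<in> W \<Longrightarrow> \<nu> v $ 2 = 0" "\<And>v. v \<in> W \<Longrightarrow> \<nu> v $ 3 = 0"
  shows "mean_curvature (induced_metric (siklos_metric \<beta> H) G u) (h u) = 0"
proof -
  define n1 n4 where "n1 = \<nu> u $ 1" and "n4 = \<nu> u $ 4"
  define s where "s = \<beta>\<^sup>2 / (G u $ 3)\<^sup>2"
  have GD: "G v \<in> D" if "v \<in> W" for v
    using imm that unfolding is_immersion_patch_def by auto
  have smG: "smooth_on W G" and sm\<nu>: "smooth_on W \<nu>"
    using imm nor unfolding is_immersion_patch_def is_unit_normal_def by auto
  note nz = siklos_spacetime_nonzero[OF sik GD]
  have s: "s \<noteq> 0" using nz[OF W(2)] unfolding s_def by simp
  have orth: "\<nu> v $ 1 * partial i G v $ 2 + \<nu> v $ 4 * partial i G v $ 4 = 0" if "v \<in> W" for v i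
  proof -
    have "form (siklos_metric \<beta> H (G v)) (partial i G v) (\<nu> v) = 0"
      using nor that unfolding is_unit_normal_def by auto
    then show ?thesis
      using nz[OF that] \<nu>[OF that] unfolding form_siklos by (simp add: mult.commute)
  qed
  have n4: "n4 \<noteq> 0"
  proof -
    have "form (siklos_metric \<beta> H (G u)) (\<nu> u) (\<nu> u) \<noteq> 0"
      using nor W unfolding is_unit_normal_def by auto
    then show ?thesis
      using \<nu>[OF W(2)] unfolding form_siklos n4_def by auto
  qed

  define N where "N = frechet_derivative \<nu> (at u)"
  have N: "(\<nu> has_derivative N) (at u)"
    unfolding N_def by (rule smooth_on_imp_has_derivative[OF sm\<nu> W(2)])
  \<comment> \<open>The relation \<open>orth\<close> holds identically on the open set
    \<open>W\<close>, so its derivative in direction i vanishes as well; this expresses the normal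
    part of the second derivatives of \<open>G\<close> through first derivatives of \<open>G\<close>
    and \<nu>.\<close>
  have dorth: "N (axis i 1) $ 1 * partial j G u $ 2 + n1 * partial i (partial j G) u $ 2
      + N (axis i 1) $ 4 * partial j G u $ 4 + n4 * partial i (partial j G) u $ 4 = 0" for i j
  proof -
    define E where "E = frechet_derivative (partial j G) (at u)"
    have "smooth_on W (partial j G)"
      using smooth_on_frechet_derivative[OF smG, of "axis j 1"] unfolding partial_def .
    then have E: "(partial j G has_derivative E) (at u)"
      unfolding E_def using smooth_on_imp_has_derivative W(2) by blast
    have "((\<lambda>v. \<nu> v $ 1 * partial j G v $ 2 + \<nu> v $ 4 * partial j G v $ 4) has_derivative
        (\<lambda>w. (n1 * E w $ 2 + N w $ 1 * partial j G u $ 2) + (n4 * E w $ 4 + N w $ 4 * partial j G u $ 4))) (at u)"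
      unfolding n1_def n4_def
      by (intro has_derivative_add has_derivative_mult bounded_linear.has_derivative[OF bounded_linear_vec_nth] N E)
    moreover have "((\<lambda>v. \<nu> v $ 1 * partial j G v $ 2 + \<nu> v $ 4 * partial j G v $ 4) has_derivative (\<lambda>w. 0)) (at u)"
      by (rule has_derivative_transform_within_open[OF has_derivative_const[of 0] W]) (simp add: orth)
    ultimately have "(\<lambda>w. (n1 * E w $ 2 + N w $ 1 * partial j G u $ 2) + (n4 * E w $ 4 + N w $ 4 * partial j G u $ 4)) = (\<lambda>w. 0)"
      by (rule has_derivative_unique)
    from fun_cong[OF this, of "axis i 1"] show ?thesis
      by (simp add: partial_def[of i] E_def algebra_simps)
  qed

  define x3 where "x3 = G u $ 3"
  define H4 where "H4 = partial 4 (on_spacetime H) (G u)"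
  define A where "A i j = ambient_derivative (siklos_metric \<beta> H) G u i j" for i j
  have A2: "A i j $ 2 = partial i (partial j G) u $ 2
      - (1 / x3) * (partial i G u $ 2 * partial j G u $ 3 + partial i G u $ 3 * partial j G u $ 2)" for i j
    unfolding A_def ambient_derivative_def x3_def
    using nz[OF W(2)] by (simp add: sum_4 christoffel_siklos_2 algebra_simps)
  have A4: "A i j $ 4 = partial i (partial j G) u $ 4
      - (1 / x3) * (partial i G u $ 4 * partial j G u $ 3 + partial i G u $ 3 * partial j G u $ 4)
      - 1/2 * H4 * (partial i G u $ 2 * partial j G u $ 2)" for i j
    unfolding A_def ambient_derivative_def x3_def H4_def
    using nz[OF W(2)] by (simp add: sum_4 christoffel_siklos_4 algebra_simps)
  \<comment> \<open>This is what remains of \<open>n1 * A i j $ 2 + n4 * A i j $ 4\<close> after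
    \<open>dorth\<close> has removed the second derivatives and \<open>G4\<close> has turned
    component 4 into component 2, divided by \<open>n4\<^sup>2\<close> and by the common factor
    \<open>partial j G u $ 2\<close>.\<close>
  define q where "q i = (N (axis i 1) $ 4 * (n1 / n4) - N (axis i 1) $ 1
      - 1/2 * n4 * H4 * partial i G u $ 2) / n4\<^sup>2" for i
  have G4: "partial i G u $ 4 = - (n1 / n4) * partial i G u $ 2" for i
    using orth[OF W(2), of i] n4 unfolding n1_def n4_def by (simp add: field_simps)
  have hq: "h u $ i $ j = q i * partial j G u $ 2" for i j
  proof -
    define I where "I = intrinsic_derivative (siklos_metric \<beta> H) G u i j"
    have "n1 * I $ 2 + n4 * I $ 4 = (\<Sum>l\<in>UNIV. christoffel (induced_metric (siklos_metric \<beta> H) G) u l i j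
        * (n1 * partial l G u $ 2 + n4 * partial l G u $ 4))"
      unfolding I_def intrinsic_derivative_def
      by (simp add: sum_distrib_left sum.distrib distrib_left mult.left_commute)
    \<comment> \<open>Pairing with \<nu> annihilates the tangential part of the Gauss formula, so
      \<open>h\<close> can be isolated.\<close>
    then have I: "n1 * I $ 2 + n4 * I $ 4 = 0"
      using orth[OF W(2)] unfolding n1_def n4_def by simp
    have "A i j = I + (h u $ i $ j) *\<^sub>R \<nu> u"
      using sff W(2) unfolding is_second_fundamental_form_def A_def I_def by auto
    then have "n1 * A i j $ 2 + n4 * A i j $ 4 = h u $ i $ j * n4\<^sup>2"
      using I \<nu>[OF W(2)] by (simp add: n4_def[symmetric] algebra_simps power2_eq_square)
    moreover have "n1 * A i j $ 2 + n4 * A i j $ 4 = n4\<^sup>2 * (q i * partial j G u $ 2)"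
    proof -
      have "n1 * A i j $ 2 + n4 * A i j $ 4 =
          (n1 * partial i (partial j G) u $ 2 + n4 * partial i (partial j G) u $ 4)
          - (1 / x3) * (partial j G u $ 3 * (n1 * partial i G u $ 2 + n4 * partial i G u $ 4)
            + partial i G u $ 3 * (n1 * partial j G u $ 2 + n4 * partial j G u $ 4))
          - 1/2 * n4 * H4 * partial i G u $ 2 * partial j G u $ 2"
        unfolding A2 A4 by (simp add: algebra_simps)
      also have "\<dots> = (- N (axis i 1) $ 1 * partial j G u $ 2 - N (axis i 1) $ 4 * partial j G u $ 4)
          - 1/2 * n4 * H4 * partial i G u $ 2 * partial j G u $ 2"
        using dorth[of i j] orth[OF W(2)] unfolding n1_def n4_def by simp
      also have "\<dots> = n4\<^sup>2 * (q i * partial j G u $ 2)"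
        using n4 unfolding G4 q_def by (simp add: field_simps)
      finally show ?thesis .
    qed
    ultimately show ?thesis using n4 by simp
  qed

  define L where "L = frechet_derivative G (at u)"
  have G': "G differentiable at u"
    using smooth_on_imp_has_derivative[OF smG W(2)] differentiableI by blast
  have linL: "linear L" unfolding L_def using G' by (rule linear_frechet_derivative)
  have L: "L v = (\<Sum>i\<in>UNIV. v $ i *\<^sub>R partial i G u)" for v
    unfolding L_def by (rule frechet_derivative_expand[OF G'])
  \<comment> \<open>A Euclidean normal of the tangent space: orthogonality to \<nu> places the range
    of \<open>L\<close> in a hyperplane, and both have dimension 3. Thus every vector satisfying the
    equation is tangent.\<close>
  define c :: "real^4" where "c = vector [0, n1, 0, n4]"
  have c: "c \<bullet> w = n1 * w $ 2 + n4 * w $ 4" for w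
    unfolding c_def by (simp add: inner_vec_def sum_4)
  have "range L = {w. c \<bullet> w = 0}"
  proof (rule subspace_dim_equal)
    show "subspace (range L)" by (intro linear_subspace_image linL subspace_UNIV)
    show "subspace {w. c \<bullet> w = 0}" by (rule subspace_hyperplane)
    have "n1 * partial i G u $ 2 + n4 * partial i G u $ 4 = 0" for i
      using orth[OF W(2)] unfolding n1_def n4_def .
    then have "c \<bullet> partial i G u = 0" for i unfolding c .
    then show "range L \<subseteq> {w. c \<bullet> w = 0}" by (auto simp: L inner_sum_right)
    have "inj L" using imm W(2) unfolding is_immersion_patch_def L_def by auto
    then have "dim (range L) = 3" using dim_image_eq[OF linL, of UNIV] by simp
    moreover have "c \<noteq> 0" using n4 unfolding c_def by (metis vector_4(4) zero_index)
    ultimately show "dim (range L) \<ge> dim {w. c \<bullet> w = 0}" by (simp add: dim_hyperplane)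
  qed
  then have ran: "\<exists>v. L v = w" if "n1 * w $ 2 + n4 * w $ 4 = 0" for w
    using that c by (metis (mono_tags, lifting) imageE mem_Collect_eq)
  obtain v where v: "L v = axis 1 1"
    using ran[of "axis 1 1"] by (auto simp: axis_def)
  \<comment> \<open>A tangent vector whose component 2 is \<open>n4\<close>, hence nonzero: dx_2
    does not vanish on M, and some \<open>j\<close> can be used for division.\<close>
  obtain w where w: "L w = vector [0, n4, 0, - n1]"
    using ran[of "vector [0, n4, 0, - n1]"] by auto
  obtain j where j: "partial j G u $ 2 \<noteq> 0"
  proof -
    have "(\<Sum>i\<in>UNIV. w $ i * partial i G u $ 2) = n4"
      using arg_cong[OF w, of "\<lambda>y. y $ 2"] unfolding L by simp
    with n4 have "\<exists>i. partial i G u $ 2 \<noteq> 0" by (metis (no_types, lifting) mult_zero_right sum.neutral)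
    with that show thesis by blast
  qed
  \<comment> \<open>Symmetry of \<open>h\<close> contracted with \<open>v\<close>, the coordinate
    vector of \<partial>_1; the right-hand side contains dx_2(\<partial>_1) = 0.\<close>
  have "(\<Sum>i\<in>UNIV. q i * v $ i) * partial j G u $ 2 = q j * (\<Sum>i\<in>UNIV. v $ i * partial i G u $ 2)"
  proof -
    have "h u $ i $ j = h u $ j $ i" for i
      using sff W(2) unfolding is_second_fundamental_form_def by blast
    then have "v $ i * (q i * partial j G u $ 2) = v $ i * (q j * partial i G u $ 2)" for i
      by (simp only: hq)
    then have "q i * v $ i * partial j G u $ 2 = q j * (v $ i * partial i G u $ 2)" for i
      by (simp only: ac_simps)
    then show ?thesis unfolding sum_distrib_left sum_distrib_right by (simp only:)
  qed
  moreover have "(\<Sum>i\<in>UNIV. v $ i * partial i G u $ 2) = 0"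
    using arg_cong[OF v, of "\<lambda>y. y $ 2"] unfolding L by (simp add: axis_def)
  ultimately have qv: "(\<Sum>i\<in>UNIV. q i * v $ i) = 0" using j by simp

  define \<gamma> where "\<gamma> = induced_metric (siklos_metric \<beta> H) G u"
  have "form (siklos_metric \<beta> H (G u)) y (L v) = s * y $ 2" for y
    unfolding v form_siklos s_def by (simp add: axis_def)
  moreover have "form (siklos_metric \<beta> H (G u)) y (L v) =
      (\<Sum>k\<in>UNIV. form (siklos_metric \<beta> H (G u)) y (partial k G u) * v $ k)" for y
    unfolding L form_def
    by (simp add: linear_sum[OF matrix_vector_mul_linear] matrix_vector_mult_scaleR inner_sum_right mult.commute)
  \<comment> \<open>Lowering the index of \<partial>_1 gives \<open>s\<close> times dx_2 restricted
    to M. Raising it again identifies \<open>v\<close>, so that the trace of q \<otimes> dx_2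
    becomes q(v)/s.\<close>
  ultimately have \<gamma>v: "\<gamma> *v v = (\<chi> i. s * partial i G u $ 2)"
    unfolding \<gamma>_def induced_metric_def by (simp add: vec_eq_iff matrix_vector_mult_def)
  have "invertible \<gamma>" using imm W(2) unfolding is_immersion_patch_def \<gamma>_def by auto
  then have "matrix_inv \<gamma> ** \<gamma> = mat 1"
    unfolding invertible_def using matrix_inv_eqI by blast
  then have "matrix_inv \<gamma> *v (\<gamma> *v v) = v"
    by (simp add: matrix_vector_mul_assoc)
  then have vi: "v $ i = s * (\<Sum>k\<in>UNIV. matrix_inv \<gamma> $ i $ k * partial k G u $ 2)" for i
    unfolding \<gamma>v by (simp add: vec_eq_iff matrix_vector_mult_def sum_distrib_left mult.left_commute)
  have "s * (\<Sum>i\<in>UNIV. \<Sum>k\<in>UNIV. matrix_inv \<gamma> $ i $ k * h u $ i $ k) = (\<Sum>i\<in>UNIV. q i * v $ i)"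
    unfolding vi hq by (simp add: sum_distrib_left mult.left_commute)
  then show ?thesis
    using qv s unfolding mean_curvature_def \<gamma>_def by simp
qed

section \<open>Local coordinates in which the hypersurface is a graph\<close>

text \<open>On tangent vectors component 4 is a multiple of component 2, so dropping component 4
  loses no information and (x_1, x_2, x_3) is a local diffeomorphism on M. Over a ball the slices
  with fixed x_2 are convex, and x_4 is constant on each of them.\<close>

lemma exists_graph_chart:
  fixes \<A> :: "('m::{t2_space, second_countable_topology}, 3) chart set"
  assumes sik: "siklos_spacetime D \<Lambda> \<beta> H"
    and hyp: "hypersurface \<A> D (siklos_metric \<beta> H) F \<xi> h"
    and \<xi>: "\<And>p. p \<in> points \<A> \<Longrightarrow> \<xi> p $ 2 = 0" "\<And>p. p \<in> points \<A> \<Longrightarrow> \<xi> p $ 3 = 0"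
    and p: "p \<in> points \<A>"
  obtains c f where "local_coordinates \<A> c" "p \<in> fst c" "smooth_on ((\<lambda>u. u$2) ` image_of c) f"
    "\<And>u. u \<in> image_of c \<Longrightarrow> in_chart c F u = graph_immersion f u"
proof -
  obtain U \<phi> where c0: "(U, \<phi>) \<in> \<A>" "p \<in> U"
    using p unfolding points_def by auto
  define W where "W = \<phi> ` U"
  define i where "i = inv_into U \<phi>"
  have charts: "is_chart d" if "d \<in> \<A>" for d
    using hyp that unfolding hypersurface_def smooth_atlas_def by blast
  have compat: "compatible d e" if "d \<in> \<A>" "e \<in> \<A>" for d e
    using hyp that unfolding hypersurface_def smooth_atlas_def by blast
  have U: "open U" "open W" "homeomorphism U W \<phi> i"
    using charts[OF c0(1)] unfolding is_chart_def W_def i_def by auto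
  define G where "G = F \<circ> i"
  define \<nu> where "\<nu> = \<xi> \<circ> i"
  have imm: "is_immersion_patch D (siklos_metric \<beta> H) W G"
    and nor: "is_unit_normal (siklos_metric \<beta> H) W G \<nu>"
    using hyp c0(1) unfolding hypersurface_def G_def \<nu>_def W_def i_def
    by (auto simp: image_of_def in_chart_def)
  have iU: "i w \<in> points \<A>" if "w \<in> W" for w
    using that c0(1) U(3) unfolding points_def homeomorphism_def by force
  have smG: "smooth_on W G" using imm unfolding is_immersion_patch_def by auto
  have slope: "\<exists>k. \<forall>v. frechet_derivative G (at w) v $ 4 = k * frechet_derivative G (at w) v $ 2"
    if w: "w \<in> W" for w
  proof -
    have "G w \<in> D" using imm w unfolding is_immersion_patch_def by auto
    note nz = siklos_spacetime_nonzero[OF sik this]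
    have \<nu>0: "\<nu> w $ 2 = 0" "\<nu> w $ 3 = 0" using \<xi> iU[OF w] unfolding \<nu>_def by auto
    have "form (siklos_metric \<beta> H (G w)) (\<nu> w) (\<nu> w) \<noteq> 0"
      using nor w unfolding is_unit_normal_def by auto
    then have \<nu>4: "\<nu> w $ 4 \<noteq> 0"
      using \<nu>0 unfolding form_siklos by auto
    have "form (siklos_metric \<beta> H (G w)) (partial j G w) (\<nu> w) = 0" for j
      using nor w unfolding is_unit_normal_def by auto
    then have "partial j G w $ 2 * \<nu> w $ 1 + partial j G w $ 4 * \<nu> w $ 4 = 0" for j
      using nz \<nu>0 unfolding form_siklos by simp
    then have "partial j G w $ 4 = - (\<nu> w $ 1 / \<nu> w $ 4) * partial j G w $ 2" for j
      using \<nu>4 by (simp add: field_simps eq_neg_iff_add_eq_0)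
    moreover have "G differentiable at w"
      using smooth_on_imp_has_derivative[OF smG w] differentiableI by blast
    ultimately have "frechet_derivative G (at w) v $ 4 = - (\<nu> w $ 1 / \<nu> w $ 4) * frechet_derivative G (at w) v $ 2" for v
      unfolding frechet_derivative_expand[OF \<open>G differentiable at w\<close>]
      by (simp add: sum_distrib_left mult.left_commute)
    then show ?thesis by blast
  qed

  define \<pi> :: "real^4 \<Rightarrow> real^3" where "\<pi> y = vector [y$1, y$2, y$3]" for y
  have \<pi>: "bounded_linear \<pi>"
    unfolding linear_conv_bounded_linear[symmetric] \<pi>_def
    by (rule linearI) (simp_all add: vec_eq_iff forall_3)
  have smooth_\<pi>: "smooth_on S (\<pi> \<circ> g)" if "open S" "smooth_on S g" for S :: "(real^3) set" and g
    using Ck_on_bounded_linear[OF that(1) \<pi>] that(2) unfolding smooth_on_def comp_def by blast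
  define T where "T = \<pi> \<circ> G"
  have smT: "smooth_on W T" unfolding T_def by (rule smooth_\<pi>[OF U(2) smG])
  have T': "(T has_derivative (\<lambda>v. \<pi> (frechet_derivative G (at w) v))) (at w)" if "w \<in> W" for w
    unfolding T_def comp_def
    by (rule bounded_linear.has_derivative[OF \<pi> smooth_on_imp_has_derivative[OF smG that]])
  have phip: "\<phi> p \<in> W" using c0 unfolding W_def by auto
  have "inj (frechet_derivative T (at (\<phi> p)))"
  proof -
    let ?L = "frechet_derivative G (at (\<phi> p))"
    have eq: "frechet_derivative T (at (\<phi> p)) = (\<lambda>v. \<pi> (?L v))"
      using frechet_derivative_at[OF T'[OF phip]] by simp
    have lin: "linear ?L"
      using has_derivative_linear[OF smooth_on_imp_has_derivative[OF smG phip]] .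
    have inj: "inj ?L" using imm phip unfolding is_immersion_patch_def by auto
    have "v = 0" if "\<pi> (?L v) = 0" for v
    proof -
      obtain k where "?L v $ 4 = k * ?L v $ 2" using slope[OF phip] by blast
      moreover have "?L v $ 1 = 0" "?L v $ 2 = 0" "?L v $ 3 = 0"
        using that unfolding \<pi>_def by (simp_all add: vec_eq_iff forall_3)
      ultimately have "?L v = 0" by (simp add: vec_eq_iff_4)
      then show ?thesis using inj lin by (simp add: linear_injective_0)
    qed
    then show ?thesis
      unfolding eq using linear_compose[OF lin bounded_linear.linear[OF \<pi>]]
      by (simp add: linear_injective_0 comp_def)
  qed
  from smooth_inverse_function[OF U(2) smT phip this]
  obtain O' V g where g: "open O'" "O' \<subseteq> W" "\<phi> p \<in> O'" "open V" "homeomorphism O' V T g" "smooth_on V g"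
    by blast
  have "T (\<phi> p) \<in> V" using homeomorphism_image1[OF g(5)] g(3) by blast
  \<comment> \<open>Shrinking to a ball provides both the convexity and the nearness to the centre
    that are used to define \<open>f\<close> below.\<close>
  with g(4) obtain e where e: "e > 0" "ball (T (\<phi> p)) e \<subseteq> V"
    unfolding open_contains_ball by blast
  define x where "x = T (\<phi> p)"
  define B where "B = ball x e"
  have BV: "B \<subseteq> V" and xB: "x \<in> B" and oB: "open B" using e unfolding B_def x_def by auto
  have gx: "g x = \<phi> p"
    unfolding x_def using g(5,3) by (rule homeomorphism_apply1)
  have gW: "g b \<in> W" and Tg: "T (g b) = b" if "b \<in> B" for b
  proof -
    have "b \<in> V" using that BV by blast
    then show "g b \<in> W" "T (g b) = b"
      using g(2,5) unfolding homeomorphism_def by auto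
  qed
  define P where "P = i ` g ` B"
  define \<psi> where "\<psi> = \<pi> \<circ> F"
  have h1: "homeomorphism (g ` B) B T g"
  proof (rule homeomorphism_of_subsets[OF g(5) _ BV])
    show "g ` B \<subseteq> O'" using homeomorphism_image2[OF g(5)] BV by auto
    show "T ` g ` B = B" using Tg by (simp add: image_image)
  qed
  have \<phi>i: "\<phi> (i w) = w" if "w \<in> W" for w
    using U(3) that by (rule homeomorphism_apply2)
  have PU: "P \<subseteq> U"
    using gW homeomorphism_image2[OF U(3)] unfolding P_def by auto
  have h2: "homeomorphism P (g ` B) \<phi> i"
    by (rule homeomorphism_of_subsets[OF U(3) PU, of "g ` B"])
      (use gW \<phi>i in \<open>auto simp: P_def image_image\<close>)
  have T\<phi>: "T (\<phi> q) = \<psi> q" if "q \<in> U" for q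
    using U(3) that unfolding T_def G_def \<psi>_def homeomorphism_def by simp
  have h3: "homeomorphism P B \<psi> (i \<circ> g)"
    by (rule homeomorphism_cong[OF homeomorphism_compose[OF h2 h1]]) (use PU T\<phi> in auto)
  \<comment> \<open>Charts are inverted by \<open>inv_into\<close>, which is known to agree with
    \<open>i \<circ> g\<close> only on \<open>B\<close>; the transition maps are therefore compared
    on subsets of \<open>B\<close>.\<close>
  have inv: "inv_into P \<psi> b = i (g b)" if "b \<in> B" for b
    using h3 that unfolding homeomorphism_def
    by (intro inv_into_f_eq) (auto simp: inj_on_def, metis)
  have oP: "open P"
  proof -
    have "openin (top_of_set O') (g ` B)"
      by (rule homeomorphism_imp_open_map[OF homeomorphism_symD[OF g(5)]])
        (use oB BV in \<open>auto simp: openin_open_eq g(4)\<close>)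
    then have "open (g ` B)" using g(1) openin_open_eq by blast
    then have "openin (top_of_set U) P"
      unfolding P_def
      by (intro homeomorphism_imp_open_map[OF homeomorphism_symD[OF U(3)]])
        (use gW U(2) in \<open>auto simp: openin_open_eq\<close>)
    then show ?thesis using U(1) openin_open_eq by blast
  qed
  have \<psi>P: "\<psi> ` P = B" using h3 by (rule homeomorphism_image1)
  have pP: "p \<in> P"
    using xB gx c0(2) U(3) unfolding P_def homeomorphism_def by (metis image_eqI)

  have "homeomorphism P B \<psi> (inv_into P \<psi>)"
    by (rule homeomorphism_cong[OF h3]) (simp_all add: inv)
  then have chart: "is_chart (P, \<psi>)"
    using oP oB unfolding is_chart_def by (simp add: \<psi>P)
  have comp: "compatible (P, \<psi>) d" if d: "d \<in> \<A>" for d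
  proof -
    obtain Q \<eta> where Q: "d = (Q, \<eta>)" by (cases d)
    have oQ: "open Q" "open (\<eta> ` Q)" using charts[OF d] unfolding is_chart_def Q by auto
    have "openin (top_of_set B) (\<psi> ` (P \<inter> Q))"
      by (rule homeomorphism_imp_open_map[OF h3]) (use oQ oP in \<open>auto simp: openin_open_eq\<close>)
    then have oS: "open (\<psi> ` (P \<inter> Q))" using oB openin_open_eq by blast
    have S: "b \<in> B \<and> g b \<in> \<phi> ` (U \<inter> Q)" if b: "b \<in> \<psi> ` (P \<inter> Q)" for b
    proof -
      obtain q where q: "q \<in> P" "q \<in> Q" "b = \<psi> q" using b by auto
      then have "b \<in> B" "i (g b) = q" using h3 unfolding homeomorphism_def by auto
      then show ?thesis using q PU \<phi>i[OF gW] by (metis IntI image_eqI subsetD)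
    qed
    have "smooth_on (\<phi> ` (U \<inter> Q)) (\<eta> \<circ> i)"
      using compat[OF c0(1) d] unfolding compatible_def Q i_def by auto
    moreover have "smooth_on (\<psi> ` (P \<inter> Q)) g"
      using g(6) S BV by (blast intro: smooth_on_subset)
    ultimately have "smooth_on (\<psi> ` (P \<inter> Q)) ((\<eta> \<circ> i) \<circ> g)"
      using S by (intro smooth_on_compose[OF oS]) auto
    then have 1: "smooth_on (\<psi> ` (P \<inter> Q)) (\<eta> \<circ> inv_into P \<psi>)"
      by (rule smooth_on_cong[OF oS, rotated]) (use S inv in auto)
    \<comment> \<open>The other transition map needs no inverse function: it is \<open>\<pi>\<close>
      applied to the coordinate expression of \<open>F\<close> in the chart \<open>d\<close>, which
      is smooth.\<close>
    have "smooth_on (\<eta> ` Q) (F \<circ> inv_into Q \<eta>)"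
      using hyp d unfolding hypersurface_def is_immersion_patch_def Q
      by (fastforce simp: image_of_def in_chart_def)
    from smooth_\<pi>[OF oQ(2) this]
    have "smooth_on (\<eta> ` (P \<inter> Q)) (\<psi> \<circ> inv_into Q \<eta>)"
      unfolding \<psi>_def comp_assoc by (rule smooth_on_subset) auto
    with 1 show ?thesis unfolding compatible_def Q by simp
  qed
  have loc: "local_coordinates \<A> (P, \<psi>)"
    using chart comp PU c0(1) unfolding local_coordinates_def points_def by force

  define K where "K = G \<circ> g"
  have smK: "smooth_on B K"
    unfolding K_def using smooth_on_compose[OF oB _ _ smG, of g] gW smooth_on_subset[OF g(6) BV] by blast
  have \<pi>K: "\<pi> (K b) = b" if "b \<in> B" for b
    using Tg[OF that] unfolding T_def K_def by simp
  \<comment> \<open>Since \<open>\<pi> \<circ> K\<close> is the identity on \<open>B\<close>, a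
    direction with vanishing component 2 is sent to a tangent vector with vanishing component 2, and
    \<open>slope\<close> then removes component 4.\<close>
  have K4: "frechet_derivative K (at b) v $ 4 = 0" if b: "b \<in> B" and v: "v $ 2 = 0" for b v
  proof -
    define M where "M = frechet_derivative g (at b)"
    have M: "(g has_derivative M) (at b)"
      unfolding M_def using smooth_on_imp_has_derivative[OF g(6)] BV b by blast
    let ?L = "frechet_derivative G (at (g b))"
    have K': "(K has_derivative (?L \<circ> M)) (at b)"
      unfolding K_def by (rule diff_chain_at[OF M smooth_on_imp_has_derivative[OF smG gW[OF b]]])
    have "((\<lambda>b. \<pi> (K b)) has_derivative (\<lambda>v. \<pi> ((?L \<circ> M) v))) (at b)"
      by (rule bounded_linear.has_derivative[OF \<pi> K'])
    moreover have "((\<lambda>b. \<pi> (K b)) has_derivative (\<lambda>v. v)) (at b)"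
      by (rule has_derivative_transform_within_open[OF has_derivative_ident oB b]) (simp add: \<pi>K)
    ultimately have "(\<lambda>v. \<pi> ((?L \<circ> M) v)) = (\<lambda>v. v)" by (rule has_derivative_unique)
    from fun_cong[OF this, of v] have "?L (M v) $ 2 = 0"
      using v unfolding \<pi>_def by (auto simp: vec_eq_iff forall_3)
    then have "?L (M v) $ 4 = 0" using slope[OF gW[OF b]] by (metis mult_zero_right)
    then show ?thesis using frechet_derivative_eqI[OF K'] by simp
  qed

  \<comment> \<open>The line through the centre of the ball in direction 2, along which
    \<open>f\<close> is sampled. The point of it with the same component 2 as \<open>u\<close> is at
    least as close to the centre as \<open>u\<close>, hence lies in \<open>B\<close>.\<close>
  define l :: "real \<Rightarrow> real^3" where "l t = (x - x $ 2 *\<^sub>R axis 2 1) + t *\<^sub>R axis 2 1" for t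
  have l_nth: "l t $ k = (if k = 2 then t else x $ k)" for t k
    unfolding l_def by (simp add: axis_def)
  have lB: "l (u $ 2) \<in> B" if "u \<in> B" for u
  proof -
    have "norm (x - l (u $ 2)) \<le> norm (x - u)"
      by (rule norm_le_componentwise_cart) (simp add: l_nth)
    then show ?thesis using that unfolding B_def by (simp add: dist_norm)
  qed
  define f where "f t = K (l t) $ 4" for t
  \<comment> \<open>The segment from \<open>u\<close> to \<open>l (u $ 2)\<close> stays in the
    convex set \<open>B\<close> and has constant component 2, so by \<open>K4\<close> component 4 of
    \<open>K\<close> is constant along it.\<close>
  have const: "K u $ 4 = f (u $ 2)" if u: "u \<in> B" for u
  proof -
    define w where "w = l (u $ 2) - u"
    have w2: "w $ 2 = 0" unfolding w_def by (simp add: l_nth)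
    have seg: "u + t *\<^sub>R w \<in> B" if "t \<in> {0..1}" for t
    proof -
      have "(1 - t) *\<^sub>R u + t *\<^sub>R l (u $ 2) \<in> B"
        using that u lB[OF u] convex_ball unfolding B_def by (intro convexD) auto
      then show ?thesis unfolding w_def by (simp add: algebra_simps)
    qed
    have "((\<lambda>t. K (u + t *\<^sub>R w) $ 4) has_derivative (\<lambda>t. 0)) (at t within {0..1})" if t: "t \<in> {0..1}" for t
    proof -
      let ?D = "frechet_derivative K (at (u + t *\<^sub>R w))"
      have "((\<lambda>t. u + t *\<^sub>R w) has_derivative (\<lambda>t. t *\<^sub>R w)) (at t)"
        by (auto intro!: derivative_eq_intros)
      from diff_chain_at[OF this smooth_on_imp_has_derivative[OF smK seg[OF t]]]
      have "((\<lambda>t. K (u + t *\<^sub>R w) $ 4) has_derivative (\<lambda>t. ?D (t *\<^sub>R w) $ 4)) (at t)"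
        using bounded_linear.has_derivative[OF bounded_linear_vec_nth] by (simp add: comp_def)
      moreover have "?D (r *\<^sub>R w) $ 4 = 0" for r
        by (rule K4) (simp_all add: seg[OF t] w2)
      ultimately show ?thesis by (simp add: has_derivative_at_withinI)
    qed
    then obtain c where "\<forall>t\<in>{0..1}. K (u + t *\<^sub>R w) $ 4 = c"
      using has_derivative_zero_constant[of "{0..1::real}" "\<lambda>t. K (u + t *\<^sub>R w) $ 4"] by auto
    from bspec[OF this, of 0] bspec[OF this, of 1] show ?thesis
      unfolding f_def w_def by simp
  qed
  have smf: "smooth_on ((\<lambda>u. u $ 2) ` B) f"
  proof -
    \<comment> \<open>The interval of values of x_2 is exactly the parameter set on which
      \<open>l\<close> runs inside \<open>B\<close>, so \<open>f\<close> is smooth there as a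
      component of \<open>K \<circ> l\<close>.\<close>
    have img: "(\<lambda>u. u $ 2) ` B = l -` B"
      using lB l_nth by (auto simp: image_iff) (metis l_nth)
    have oI: "open (l -` B)"
      using oB by (rule open_vimage) (auto simp: l_def intro!: continuous_intros)
    have "smooth_on (l -` B) l"
      unfolding smooth_on_def l_def
      by (intro allI Ck_on_add Ck_on_const Ck_on_scaleR Ck_on_ident) (use oI in \<open>simp_all add: l_def[abs_def]\<close>)
    from smooth_on_compose[OF oI _ this smK] have "smooth_on (l -` B) (K \<circ> l)" by auto
    from smooth_on_nth[OF oI this] show ?thesis unfolding img f_def comp_def .
  qed
  have "in_chart (P, \<psi>) F u = graph_immersion f u" if "u \<in> image_of (P, \<psi>)" for u
  proof -
    have u: "u \<in> B" using that \<psi>P unfolding image_of_def by simp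
    have "in_chart (P, \<psi>) F u = K u"
      unfolding in_chart_def K_def G_def using inv[OF u] by simp
    then show ?thesis
      using const[OF u] arg_cong[OF \<pi>K[OF u], of "\<lambda>y. y $ 1"] arg_cong[OF \<pi>K[OF u], of "\<lambda>y. y $ 2"]
        arg_cong[OF \<pi>K[OF u], of "\<lambda>y. y $ 3"]
      unfolding graph_immersion_def \<pi>_def by (simp add: vec_eq_iff_4)
  qed
  with loc pP smf show thesis
    by (intro that[of "(P, \<psi>)" f]) (simp_all add: image_of_def \<psi>P)
qed

section \<open>Minimality of the given hypersurface and of every graph\<close>

lemma minimal_if_normal_in_span:
  assumes sik: "siklos_spacetime D \<Lambda> \<beta> H"
    and hyp: "hypersurface \<A> D (siklos_metric \<beta> H) F \<xi> h"
    and \<xi>: "\<And>p. p \<in> points \<A> \<Longrightarrow> \<xi> p $ 2 = 0" "\<And>p. p \<in> points \<A> \<Longrightarrow> \<xi> p $ 3 = 0"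
  shows "minimal \<A> (siklos_metric \<beta> H) F h"
  unfolding minimal_def
proof (intro ballI)
  fix c u assume c: "c \<in> \<A>" and u: "u \<in> image_of c"
  obtain U \<phi> where U: "c = (U, \<phi>)" by (cases c)
  have "open (image_of c)"
    using hyp c unfolding hypersurface_def smooth_atlas_def is_chart_def image_of_def by fastforce
  moreover have "in_chart c \<xi> v $ 2 = 0" "in_chart c \<xi> v $ 3 = 0" if "v \<in> image_of c" for v
  proof -
    have "inv_into U \<phi> v \<in> points \<A>"
      using that c unfolding U image_of_def points_def by (force intro: inv_into_into)
    then show "in_chart c \<xi> v $ 2 = 0" "in_chart c \<xi> v $ 3 = 0"
      using \<xi> unfolding U in_chart_def by auto
  qed
  ultimately show "mean_curvature (induced_metric (siklos_metric \<beta> H) (in_chart c F) u) (h c u) = 0"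
    using mean_curvature_eq_0[OF sik] u c hyp unfolding hypersurface_def by blast
qed

text \<open>A graph with x_4 depending on u_2 alone has \<partial>_1 and \<partial>_3 as tangent
  vectors. Up to the nonzero conformal factor their pairings with \<nu> are components 2 and 3 of
  \<nu>.\<close>

lemma graph_normal_in_span:
  assumes sik: "siklos_spacetime D \<Lambda> \<beta> H"
    and hyp: "hypersurface {(W, id)} D (siklos_metric \<beta> H) (graph_immersion f) \<nu> k"
    and W: "u \<in> W"
  shows "\<nu> u $ 2 = 0" "\<nu> u $ 3 = 0"
proof -
  define G where "G = graph_immersion f \<circ> inv_into W id"
  have inv: "inv_into W id v = v" if "v \<in> W" for v
    using inv_into_f_f[of id W v] that by simp
  have "open W"
    using hyp unfolding hypersurface_def smooth_atlas_def is_chart_def by auto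
  have imm: "is_immersion_patch D (siklos_metric \<beta> H) W G"
    and nor: "is_unit_normal (siklos_metric \<beta> H) W G (\<nu> \<circ> inv_into W id)"
    using hyp unfolding hypersurface_def G_def by (auto simp: image_of_def in_chart_def)
  have GD: "G u \<in> D" using imm W unfolding is_immersion_patch_def by auto
  have "G differentiable at u"
    using imm W smooth_on_imp_has_derivative differentiableI unfolding is_immersion_patch_def by blast
  note line = frechet_derivative_along_line[OF this \<open>open W\<close> W]
  have "partial 1 G u = axis 1 1" "partial 3 G u = axis 3 1"
    unfolding partial_def
    by (rule line; use W in \<open>simp add: G_def inv graph_immersion_def vec_eq_iff_4 axis_def\<close>)+
  moreover have "form (siklos_metric \<beta> H (G u)) (partial i G u) (\<nu> u) = 0" for i
    using nor W inv unfolding is_unit_normal_def by auto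
  ultimately have "form (siklos_metric \<beta> H (G u)) (axis 1 1) (\<nu> u) = 0"
    "form (siklos_metric \<beta> H (G u)) (axis 3 1) (\<nu> u) = 0" by metis+
  then show "\<nu> u $ 2 = 0" "\<nu> u $ 3 = 0"
    using siklos_spacetime_nonzero[OF sik GD] unfolding form_siklos by (simp_all add: axis_def)
qed

lemma isometry_id:
  assumes "open D"
  shows "isometry D g id"
proof -
  have "smooth_on D id" unfolding id_def by (rule smooth_on_ident)
  moreover have "smooth_on D (inv_into D id)"
    by (rule smooth_on_cong[OF assms _ smooth_on_ident]) (metis inv_into_f_f id_apply inj_on_id)
  ultimately show ?thesis unfolding isometry_def by simp
qed

theorem theorem3p3:
  fixes D :: "(real^4) set" and \<Lambda> \<beta> :: real and H :: "real \<Rightarrow> real \<Rightarrow> real \<Rightarrow> real"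
    and \<A> :: "('m::{t2_space, second_countable_topology}, 3) chart set"
    and F \<xi> :: "'m \<Rightarrow> real^4" and h :: "('m, 3) chart \<Rightarrow> 3 form_field"
    and a \<theta> :: "'m \<Rightarrow> real"
  assumes "siklos_spacetime D \<Lambda> \<beta> H"
    and "hypersurface \<A> D (siklos_metric \<beta> H) F \<xi> h"
    and "codazzi \<A> (siklos_metric \<beta> H) F h"
    and "\<And>p. p \<in> points \<A> \<Longrightarrow>
      \<xi> p = a p *\<^sub>R axis 1 1 + (F p $ 3 / \<beta> * cos (\<theta> p)) *\<^sub>R axis 3 1
        + (F p $ 3 / \<beta> * sin (\<theta> p)) *\<^sub>R axis 4 1"
    and "\<And>p. p \<in> points \<A> \<Longrightarrow>
      (D2 H 3 3 (F p) - D2 H 4 4 (F p)) * sin (2 * \<theta> p) = 2 * D2 H 3 4 (F p) * cos (2 * \<theta> p)"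
    and "\<And>p. p \<in> points \<A> \<Longrightarrow> cos (\<theta> p) = 0"
  shows "(\<forall>p\<in>points \<A>. \<exists>c \<Phi> f.
          local_coordinates \<A> c \<and> p \<in> fst c \<and>
          isometry D (siklos_metric \<beta> H) \<Phi> \<and>
          solves_functional_equation H (image_of c) f \<and>
          (\<forall>u\<in>image_of c. in_chart c (\<Phi> \<circ> F) u = graph_immersion f u)) \<and>
      minimal \<A> (siklos_metric \<beta> H) F h \<and>
      (\<forall>W f \<nu> k. open W \<and> solves_functional_equation H W f \<and>
          hypersurface {(W, id)} D (siklos_metric \<beta> H) (graph_immersion f) \<nu> k \<longrightarrow>
          minimal {(W, id)} (siklos_metric \<beta> H) (graph_immersion f) k)"
proof (intro conjI ballI allI impI)
  have \<xi>: "\<xi> p $ 2 = 0" "\<xi> p $ 3 = 0" if "p \<in> points \<A>" for p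
    using assms(4,6)[OF that] by (simp_all add: axis_def)
  have D2: "D2 H 3 4 (F p) = 0" if "p \<in> points \<A>" for p
  proof -
    have "sin (2 * \<theta> p) = 0" "cos (2 * \<theta> p) = - 1"
      using assms(6)[OF that] by (simp_all add: sin_double cos_double_cos)
    then show ?thesis using assms(5)[OF that] by simp
  qed
  show "minimal \<A> (siklos_metric \<beta> H) F h"
    by (rule minimal_if_normal_in_span[OF assms(1,2) \<xi>])
  \<comment> \<open>The minimality lemma is stated for an arbitrary atlas and so covers a graph in
    its single global chart; here the form of the normal is derived from the graph.\<close>
  show "minimal {(W, id)} (siklos_metric \<beta> H) (graph_immersion f) k"
    if "open W \<and> solves_functional_equation H W f \<and>
      hypersurface {(W, id)} D (siklos_metric \<beta> H) (graph_immersion f) \<nu> k" for W f \<nu> k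
    using that graph_normal_in_span[OF assms(1)]
    by (intro minimal_if_normal_in_span[OF assms(1)]) (auto simp: points_def)
  fix p assume p: "p \<in> points \<A>"
  obtain c f where c: "local_coordinates \<A> c" "p \<in> fst c" "smooth_on ((\<lambda>u. u$2) ` image_of c) f"
    "\<And>u. u \<in> image_of c \<Longrightarrow> in_chart c F u = graph_immersion f u"
    using exists_graph_chart[OF assms(1,2) \<xi> p] by blast
  obtain U \<phi> where U: "c = (U, \<phi>)" by (cases c)
  \<comment> \<open>In the new chart the graph point is the image under \<open>F\<close> of a point
    of M, where the mixed derivative is already known to vanish.\<close>
  have "D2 H 3 4 (graph_immersion f u) = 0" if "u \<in> image_of c" for u
  proof -
    have "inv_into U \<phi> u \<in> points \<A>"
      using that c(1) unfolding U local_coordinates_def image_of_def by (force intro: inv_into_into)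
    then show ?thesis
      using D2 c(4)[OF that, symmetric] unfolding U in_chart_def by simp
  qed
  with c(3) have "solves_functional_equation H (image_of c) f"
    unfolding solves_functional_equation_def by blast
  moreover have "isometry D (siklos_metric \<beta> H) id"
    using assms(1) unfolding siklos_spacetime_def by (intro isometry_id) blast
  ultimately show "\<exists>c \<Phi> f. local_coordinates \<A> c \<and> p \<in> fst c \<and>
      isometry D (siklos_metric \<beta> H) \<Phi> \<and> solves_functional_equation H (image_of c) f \<and>
      (\<forall>u\<in>image_of c. in_chart c (\<Phi> \<circ> F) u = graph_immersion f u)"
    using c by (intro exI[of _ c] exI[of _ id] exI[of _ f]) auto
qed

end
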